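(* Let $n,k,m$ be positive integers with $n\ge k\ge 1$, $n-m\ge 1$, and $n-m+k-j\ge 1$ for all $0\le j\le m$. Then the Ward-Lah numbers $W(n,k)$ satisfy $$W(n,k)=\frac{(n+k)!}{k!}\sum_{j=0}^{m}\frac{(k-j)!}{(n-m+k-j)!}\binom{m}{j}\,W(n-m,k-j),$$ where terms with $j>k$ are interpreted as $0$.
   Context: Partition transformation: for integers $n,k\ge 0$ and a sequence $a_1,a_2,\dots$, $$P_n^k(a_1,a_2,\dots)=\sum_{q}(-1)^{q_0}\prod_{j=0}^{\ell(q)-1}\binom{q_j}{q_{j+1}}a_{j+1}^{q_j},$$ where the sum is over integer partitions $q=(q_0\ge q_1\ge\dots)$ of $n=q_0+q_1+\cdots$ with $q_0=k$; $\ell(q)$ is the length of $q$ (number of positive parts), so $q_{\ell(q)-1}>0$ and $q_{\ell(q)}=0$. Falling factorial: $x^{\underline{n}}=\prod_{i=0}^{n-1}(x-i)$. Ward-Lah numbers: for integers $n\ge k\ge 0$, $W(n,k)=(-1)^k (n+k)^{\underline{n}}\,P_n^k(1,1,\dots)$ (all $a_i=1$), with $W(0,0)=1$, $W(n,0)=0$ for $n\ge 1$, $W(0,k)=0$ for $k\ge 1$, and $W(n,k)=0$ for $k>n$. *)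

theory Defs
  imports Complex_Main
begin

text \<open>
  An integer partition \<open>q\<^sub>0 \<ge> q\<^sub>1 \<ge> \<dots>\<close> is encoded as a weakly decreasing function on \<open>nat\<close> with
  finite support, i.e. padded with zeros after its last positive part.
\<close>

definition partition_length :: "(nat \<Rightarrow> nat) \<Rightarrow> nat" where
  "partition_length q = card {j. q j > 0}"

definition partitions_with_first :: "nat \<Rightarrow> nat \<Rightarrow> (nat \<Rightarrow> nat) set" where
  "partitions_with_first n k =
     {q. antimono q \<and> finite {j. q j > 0} \<and> (\<Sum>j<partition_length q. q j) = n \<and> q 0 = k}"

lemma partition_pos_iff:
  assumes "antimono q" "finite {j. q j > (0::nat)}"
  shows "q j > 0 \<longleftrightarrow> j < partition_length q"
proof -
  have down: "q i > 0" if "q j > 0" "i \<le> j" for i j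
    using antimonoD[OF assms(1) that(2)] that(1) by linarith
  have "{j. q j > 0} \<noteq> UNIV"
    using assms(2) by (metis infinite_UNIV_nat)
  then obtain i where i: "q i = 0"
    by fast
  define l where "l = (LEAST i. q i = 0)"
  have l0: "q l = 0"
    unfolding l_def using i by (rule LeastI)
  have lpos: "q i > 0" if "i < l" for i
    using not_less_Least[of i "\<lambda>i. q i = 0"] that by (simp add: l_def)
  have iff: "q j > 0 \<longleftrightarrow> j < l" for j
    using down[of j l] l0 lpos[of j] by linarith
  then have "partition_length q = l"
    by (simp add: partition_length_def lessThan_def[symmetric])
  with iff show ?thesis
    by simp
qed

lemma finite_partitions_with_first: "finite (partitions_with_first n k)"
proof -
  have "partitions_with_first n k \<subseteq> {q. \<forall>j. (j \<in> {..<n} \<longrightarrow> q j \<in> {..n}) \<and> (j \<notin> {..<n} \<longrightarrow> q j = 0)}"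
  proof (clarify, intro conjI impI)
    fix q j
    assume "q \<in> partitions_with_first n k"
    then have q: "antimono q" "finite {j. q j > 0}" "(\<Sum>j<partition_length q. q j) = n"
      by (auto simp: partitions_with_first_def)
    note pos = partition_pos_iff[OF q(1,2)]
    have "(\<Sum>j<partition_length q. 1) \<le> (\<Sum>j<partition_length q. q j)"
      using pos by (intro sum_mono) (simp add: Suc_leI)
    then have len: "partition_length q \<le> n"
      using q(3) by simp
    show "q j \<in> {..n}"
    proof (cases "j < partition_length q")
      case True
      then show ?thesis using member_le_sum[of j "{..<partition_length q}" q] q(3) by simp
    qed (use pos[of j] in simp)
    show "q j = 0" if "j \<notin> {..<n}"
      using that len pos[of j] by simp
  qed
  then show ?thesis
    by (rule finite_subset) (intro finite_set_of_finite_funs; simp)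
qed

text \<open>The sequence \<open>a\<^sub>1, a\<^sub>2, \<dots>\<close> is a function on \<open>nat\<close> whose value at \<open>0\<close> is never used.\<close>

definition partition_transform :: "nat \<Rightarrow> nat \<Rightarrow> (nat \<Rightarrow> 'a :: comm_ring_1) \<Rightarrow> 'a" where
  "partition_transform n k a =
     (\<Sum>q\<in>partitions_with_first n k.
        (-1) ^ q 0 * (\<Prod>j<partition_length q. of_nat (q j choose q (Suc j)) * a (Suc j) ^ q j))"

definition falling_factorial :: "'a :: comm_ring_1 \<Rightarrow> nat \<Rightarrow> 'a" where
  "falling_factorial x n = (\<Prod>i<n. x - of_nat i)"

text \<open>
  For \<open>k \<le> n\<close> the defining formula already gives \<open>W(0,0) = 1\<close> and \<open>W(n,0) = 0\<close> for \<open>n \<ge> 1\<close>,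
  so only \<open>k > n\<close> needs a separate convention.
\<close>

definition ward_lah :: "nat \<Rightarrow> nat \<Rightarrow> int" where
  "ward_lah n k =
     (if k \<le> n
      then (-1) ^ k * falling_factorial (int (n + k)) n * partition_transform n k (\<lambda>_. 1)
      else 0)"

lemma partitions_with_first_0: "partitions_with_first n 0 = (if n = 0 then {\<lambda>_. 0} else {})"
proof -
  have zero: "q = (\<lambda>_. 0)" if "q \<in> partitions_with_first n 0" for q
  proof
    fix j
    have "antimono q" "q 0 = 0"
      using that by (simp_all add: partitions_with_first_def)
    then show "q j = 0"
      using antimonoD[of q 0 j] by simp
  qed
  then have sub: "partitions_with_first n 0 \<subseteq> {\<lambda>_. 0}"
    by blast
  have mem: "(\<lambda>_. 0) \<in> partitions_with_first n 0 \<longleftrightarrow> n = 0"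
    by (auto simp: partitions_with_first_def partition_length_def monotone_on_def)
  show ?thesis
  proof (cases "n = 0")
    case True
    then show ?thesis using sub mem by (simp add: set_eq_subset)
  next
    case False
    then have "partitions_with_first n 0 \<noteq> {\<lambda>_. 0}" using mem by (metis singletonI)
    with sub False show ?thesis by (simp add: subset_singleton_iff)
  qed
qed

lemma ward_lah_0_0: "ward_lah 0 0 = 1"
  by (simp add: ward_lah_def partition_transform_def partitions_with_first_0
      falling_factorial_def partition_length_def)

lemma ward_lah_0_right: "n \<ge> 1 \<Longrightarrow> ward_lah n 0 = 0"
  by (simp add: ward_lah_def partition_transform_def partitions_with_first_0)

lemma ward_lah_eq_0: "k > n \<Longrightarrow> ward_lah n k = 0"
  by (simp add: ward_lah_def)

end

theory Submission
  imports Defs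
begin

text \<open>
  Deleting the first part of a partition gives the recursion
  \<open>P\<^sub>k\<^sub>+\<^sub>n\<^sup>k(a\<^sub>1, a\<^sub>2, \<dots>) = a\<^sub>1\<^sup>k \<Sum>\<^sub>i (-1)\<^sup>k\<^sup>+\<^sup>i (k choose i) P\<^sub>n\<^sup>i(a\<^sub>2, a\<^sub>3, \<dots>)\<close>. For \<open>a = (1, 1, \<dots>)\<close>
  it is solved, by Vandermonde's identity, by \<open>(-1)\<^sup>k (n - 1 choose k - 1)\<close>, so that
  \<open>W(n, k) = (n + k)! / k! (n - 1 choose k - 1)\<close>. After cancelling the factorials, the theorem is
  Vandermonde's identity for \<open>n - 1 = m + (n - m - 1)\<close>.
\<close>

text \<open>\<open>case_nat k q\<close> puts \<open>k\<close> in front of \<open>q\<close> as a new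
  first part. Since \<open>k > 0\<close>, this is a genuine part, so it counts in the
  length.\<close>

lemma support_case_nat:
  assumes "k > 0"
  shows "{j. case_nat k q j > 0} = insert 0 (Suc ` {j. q j > 0})"
proof (rule set_eqI)
  show "j \<in> {j. case_nat k q j > 0} \<longleftrightarrow> j \<in> insert 0 (Suc ` {j. q j > 0})" for j
    using assms by (cases j) auto
qed

lemma partition_length_case_nat:
  assumes "k > 0" "finite {j. q j > 0}"
  shows "partition_length (case_nat k q) = Suc (partition_length q)"
  using assms by (simp add: partition_length_def support_case_nat card_image)

lemma antimono_case_nat_iff:
  fixes q :: "nat \<Rightarrow> nat"
  shows "antimono (case_nat k q) \<longleftrightarrow> antimono q \<and> q 0 \<le> k"
proof -
  have "(\<forall>j. case_nat k q (Suc j) \<le> case_nat k q j) \<longleftrightarrow> (\<forall>j. q (Suc j) \<le> q j) \<and> q 0 \<le> k"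
    using nat.exhaust by (metis nat.case)
  then show ?thesis
    by (simp only: antimono_iff_le_Suc)
qed

text \<open>Here \<open>i\<close> is the first part of the tail \<open>q\<close>, bounded by
  \<open>k\<close> because parts decrease weakly; the empty tail is the case
  \<open>i = 0\<close>.\<close>

lemma case_nat_partition_iff:
  assumes "k > 0"
  shows "case_nat k q \<in> partitions_with_first (k + n) k \<longleftrightarrow>
    (\<exists>i\<le>k. q \<in> partitions_with_first n i)"
proof -
  have fin: "finite {j. case_nat k q j > 0} \<longleftrightarrow> finite {j. q j > 0}"
    using assms by (simp add: support_case_nat finite_image_iff)
  show ?thesis
    using assms
    by (auto simp: partitions_with_first_def fin antimono_case_nat_iff partition_length_case_nat
        sum.lessThan_Suc_shift simp del: sum.lessThan_Suc)
qed

lemma partitions_with_first_add: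
  assumes "k > 0"
  shows "partitions_with_first (k + n) k = case_nat k ` (\<Union>i\<le>k. partitions_with_first n i)"
proof
  show "partitions_with_first (k + n) k \<subseteq> case_nat k ` (\<Union>i\<le>k. partitions_with_first n i)"
  proof
    fix q assume q: "q \<in> partitions_with_first (k + n) k"
    then have eq: "q = case_nat k (\<lambda>j. q (Suc j))"
      by (auto simp: partitions_with_first_def fun_eq_iff split: nat.splits)
    with q have "\<exists>i\<le>k. (\<lambda>j. q (Suc j)) \<in> partitions_with_first n i"
      by (metis case_nat_partition_iff[OF assms])
    then show "q \<in> case_nat k ` (\<Union>i\<le>k. partitions_with_first n i)"
      using eq by blast
  qed
  show "case_nat k ` (\<Union>i\<le>k. partitions_with_first n i) \<subseteq> partitions_with_first (k + n) k"
    by (auto simp: case_nat_partition_iff[OF assms])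
qed

lemma partition_transform_add:
  assumes "k > 0"
  shows "partition_transform (k + n) k a =
    a 1 ^ k * (\<Sum>i\<le>k. (-1) ^ (k + i) * of_nat (k choose i) *
      partition_transform n i (\<lambda>j. a (Suc j)))"
proof -
  define t where "t b q =
    (-1) ^ q 0 * (\<Prod>j<partition_length q. of_nat (q j choose q (Suc j)) * b (Suc j) ^ q j)"
    for b :: "nat \<Rightarrow> 'a" and q
  have inj: "inj_on (case_nat k) A" for A :: "(nat \<Rightarrow> nat) set"
    by (rule inj_onI) (metis ext nat.case(2))
  \<comment> \<open>The new factor at index 0 is \<open>(k choose i) * a 1 ^ k\<close>. The sign
    passes from exponent \<open>i\<close> to exponent \<open>k\<close>, which amounts to a factor
    \<open>(-1) ^ (k + i)\<close>.\<close>
  have t: "t a (case_nat k q) =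
      a 1 ^ k * ((-1) ^ (k + i) * of_nat (k choose i) * t (\<lambda>j. a (Suc j)) q)"
    if "q \<in> partitions_with_first n i" for q i
  proof -
    have "finite {j. q j > 0}" "q 0 = i"
      using that by (auto simp: partitions_with_first_def)
    then show ?thesis
      using assms
      by (simp add: t_def partition_length_case_nat prod.lessThan_Suc_shift power_add mult_ac
          del: prod.lessThan_Suc)
  qed
  have "partition_transform (k + n) k a =
      (\<Sum>q\<in>(\<Union>i\<le>k. partitions_with_first n i). t a (case_nat k q))"
    unfolding partition_transform_def partitions_with_first_add[OF assms]
    by (simp add: sum.reindex[OF inj] t_def)
  also have "\<dots> = (\<Sum>i\<le>k. \<Sum>q\<in>partitions_with_first n i. t a (case_nat k q))"
    \<comment> \<open>The families are disjoint for different \<open>i\<close>, since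
      \<open>i\<close> is recovered as \<open>q 0\<close>.\<close>
    by (rule sum.UNION_disjoint)
      (auto simp: finite_partitions_with_first, auto simp: partitions_with_first_def)
  also have "\<dots> = (\<Sum>i\<le>k. \<Sum>q\<in>partitions_with_first n i.
      a 1 ^ k * ((-1) ^ (k + i) * of_nat (k choose i) * t (\<lambda>j. a (Suc j)) q))"
    by (intro sum.cong refl t)
  also have "\<dots> = a 1 ^ k * (\<Sum>i\<le>k. (-1) ^ (k + i) * of_nat (k choose i) *
      partition_transform n i (\<lambda>j. a (Suc j)))"
    by (simp add: partition_transform_def t_def sum_distrib_left)
  finally show ?thesis .
qed

lemma partition_transform_0_right: "partition_transform n 0 a = (if n = 0 then 1 else 0)"
  by (simp add: partition_transform_def partitions_with_first_0 partition_length_def)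

text \<open>The first part alone would already exceed the total \<open>n\<close>, so the sum is
  empty.\<close>

lemma partition_transform_eq_0:
  assumes "k > n"
  shows "partition_transform n k a = 0"
proof -
  have False if "q \<in> partitions_with_first n k" for q
  proof -
    have q: "antimono q" "finite {j. q j > 0}" "(\<Sum>j<partition_length q. q j) = n" "q 0 = k"
      using that by (auto simp: partitions_with_first_def)
    then have "0 < partition_length q"
      using assms partition_pos_iff[OF q(1,2), of 0] by simp
    then show False
      using member_le_sum[of 0 "{..<partition_length q}" q] q assms by simp
  qed
  then have "partitions_with_first n k = {}"
    by blast
  then show ?thesis
    by (simp add: partition_transform_def)
qed

lemma partition_transform_const_1:
  "partition_transform (Suc n) (Suc k) (\<lambda>_. 1) =
    ((-1) ^ Suc k * of_nat (n choose k) :: 'a :: comm_ring_1)"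
proof (induction n arbitrary: k rule: less_induct)
  case (less n)
  consider "n < k" | "n = k" | p where "n = k + Suc p"
    by (metis add_Suc_right less_imp_Suc_add linorder_neqE_nat)
  then show ?case
  proof cases
    case 1
    then show ?thesis
      by (simp add: partition_transform_eq_0 binomial_eq_0)
  next
    \<comment> \<open>The first part exhausts the total, so only the empty tail \<open>i = 0\<close>
      contributes.\<close>
    case 2
    then show ?thesis
      using partition_transform_add[of "Suc k" 0 "\<lambda>_. 1 :: 'a"]
      by (simp add: partition_transform_0_right partition_transform_eq_0 sum.atMost_Suc_shift
          del: binomial_Suc_Suc sum.atMost_Suc)
  next
    case (3 p)
    \<comment> \<open>The tail has positive total \<open>Suc p\<close>, so the term for
      \<open>i = 0\<close> vanishes and the index can be shifted by one.\<close>
    have "partition_transform (Suc n) (Suc k) (\<lambda>_. 1) =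
        (\<Sum>i\<le>k. (-1) ^ (Suc k + Suc i) * of_nat (Suc k choose Suc i) *
          partition_transform (Suc p) (Suc i) (\<lambda>_. 1 :: 'a))"
      using partition_transform_add[of "Suc k" "Suc p" "\<lambda>_. 1 :: 'a"] 3
      by (simp add: partition_transform_0_right sum.atMost_Suc_shift del: binomial_Suc_Suc sum.atMost_Suc)
    also have "\<dots> = (\<Sum>i\<le>k. (-1) ^ Suc k * of_nat ((p choose i) * (Suc k choose (k - i))))"
    proof (rule sum.cong[OF refl])
      fix i assume "i \<in> {..k}"
      \<comment> \<open>Symmetry makes the lower indices \<open>i\<close> and \<open>k - i\<close>
        add up to \<open>k\<close>, as Vandermonde's identity requires.\<close>
      then have "Suc k choose Suc i = Suc k choose (k - i)"
        by (subst binomial_symmetric) auto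
      then show "(-1) ^ (Suc k + Suc i) * of_nat (Suc k choose Suc i) *
          partition_transform (Suc p) (Suc i) (\<lambda>_. 1) =
          ((-1) ^ Suc k * of_nat ((p choose i) * (Suc k choose (k - i))) :: 'a)"
        using less.IH[of p i] 3 by (simp add: power_add mult_ac del: binomial_Suc_Suc)
    qed
    also have "\<dots> = (-1) ^ Suc k * of_nat (\<Sum>i\<le>k. (p choose i) * (Suc k choose (k - i)))"
      by (simp add: sum_distrib_left)
    also have "(\<Sum>i\<le>k. (p choose i) * (Suc k choose (k - i))) = n choose k"
      using 3 by (simp add: vandermonde add.commute)
    finally show ?thesis .
  qed
qed

lemma falling_factorial_fact:
  "falling_factorial (of_nat (n + k)) n * fact k = (fact (n + k) :: 'a :: {comm_ring_1, semiring_char_0})"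
proof (induction n)
  case 0
  then show ?case
    by (simp add: falling_factorial_def)
next
  case (Suc n)
  \<comment> \<open>Splitting off the leading factor lowers the argument by one, which matches the
    induction hypothesis.\<close>
  have "falling_factorial (of_nat (Suc n + k)) (Suc n) =
      of_nat (Suc n + k) * (falling_factorial (of_nat (n + k)) n :: 'a)"
    by (simp add: falling_factorial_def prod.lessThan_Suc_shift del: prod.lessThan_Suc)
  with Suc show ?case
    by (simp add: mult.assoc)
qed

text \<open>The sign in the definition cancels the one in
  \<open>partition_transform_const_1\<close>. The factorial is kept on the left to stay within the
  integers.\<close>

lemma ward_lah_Suc_Suc:
  "fact (Suc k) * ward_lah (Suc n) (Suc k) = fact (Suc n + Suc k) * int (n choose k)"
proof (cases "k \<le> n")
  case True
  define F where "F = falling_factorial (int (Suc n + Suc k)) (Suc n)"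
  have "ward_lah (Suc n) (Suc k) = ((-1) ^ Suc k * (-1) ^ Suc k) * F * int (n choose k)"
    using True by (simp only: ward_lah_def partition_transform_const_1 F_def Suc_le_mono if_True mult_ac)
  also have "(-1 :: int) ^ Suc k * (-1) ^ Suc k = 1"
    by (simp flip: power_mult_distrib)
  finally have "fact (Suc k) * ward_lah (Suc n) (Suc k) = F * fact (Suc k) * int (n choose k)"
    by (simp only: mult_ac mult_1)
  then show ?thesis
    by (simp only: F_def falling_factorial_fact)
qed (simp add: ward_lah_eq_0)

lemma ward_lah_Suc_Suc_real:
  "real_of_int (ward_lah (Suc n) (Suc k)) =
    fact (Suc n + Suc k) / fact (Suc k) * real (n choose k)"
  using arg_cong[OF ward_lah_Suc_Suc[of k n], of real_of_int]
  by (simp add: field_simps del: fact_Suc)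

theorem theorem2p8:
  fixes n k m :: nat
  assumes "n \<ge> 1" and "k \<ge> 1" and "m \<ge> 1"
    and "n \<ge> k"
    and "int n - int m \<ge> 1"
    and "\<forall>j\<in>{0..m}. int n - int m + int k - int j \<ge> 1"
  shows "real_of_int (ward_lah n k) =
    fact (n + k) / fact k *
      (\<Sum>j = 0..m.
        if j > k then 0
        else fact (k - j) / fact (n - m + k - j) * real (m choose j)
               * real_of_int (ward_lah (n - m) (k - j)))"
proof -
  obtain l where k: "k = Suc l"
    using assms(2) by (cases k) auto
  obtain p where n: "n = Suc (m + p)"
    using assms(5) less_iff_Suc_add[of m n] by auto
  have "(\<Sum>j = 0..m.
        if j > k then 0
        else fact (k - j) / fact (n - m + k - j) * real (m choose j)
               * real_of_int (ward_lah (n - m) (k - j))) =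
      (\<Sum>j = 0..m. if j \<le> l then real ((m choose j) * (p choose (l - j))) else 0)"
  proof (rule sum.cong[OF refl])
    fix j
    \<comment> \<open>For \<open>j = k\<close> the term contains \<open>ward_lah (n - m) 0\<close>,
      which is 0 because \<open>n - m = Suc p\<close> is positive. For \<open>j \<le> l\<close> the
      factorials of the closed form cancel the quotient in front.\<close>
    consider "j \<le> l" | "j = k" | "j > k"
      unfolding k by linarith
    then show "(if j > k then 0
        else fact (k - j) / fact (n - m + k - j) * real (m choose j)
               * real_of_int (ward_lah (n - m) (k - j))) =
        (if j \<le> l then real ((m choose j) * (p choose (l - j))) else 0)"
    proof cases
      case 1
      then have "k - j = Suc (l - j)" "n - m = Suc p" "n - m + k - j = Suc p + Suc (l - j)"
        by (auto simp: k n)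
      with 1 show ?thesis
        by (simp only: ward_lah_Suc_Suc_real) (simp add: k del: fact_Suc add_Suc add_Suc_right)
    qed (auto simp: k n ward_lah_0_right)
  qed
  also have "\<dots> = (\<Sum>j\<le>l. real ((m choose j) * (p choose (l - j))))"
    \<comment> \<open>The ranges differ only in zero terms: \<open>m choose j\<close> vanishes for
      \<open>j > m\<close>, and the conditional gives 0 for \<open>j > l\<close>.\<close>
    by (rule sum.mono_neutral_cong) auto
  also have "\<dots> = real (m + p choose l)"
    by (simp flip: vandermonde)
  finally show ?thesis
    by (simp only: n k ward_lah_Suc_Suc_real)
qed

end
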